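(* Let $q$ be a prime power, let $d \in \mathbb{N}$, and suppose that $0 < m \leq n$ are integers. Let $\Phi = (\phi_1,\dots, \phi_n) : \mathbb{F}_q^m \rightarrow \mathbb{F}_q^n$ be a polynomial map, in which each $\phi_i$ is a polynomial over $\mathbb{F}_q$ in $m$ variables with total degree $\leq d$. Suppose that $|\Phi^{-1}(0)|$ is coprime to $q$ (so in particular $0 \in \operatorname{im}(\Phi)$). Let $A \subset \mathbb{F}_q^n$ be a set such that $A - A = \{a - a' : a, a' \in A\}$ intersects $\operatorname{im}(\Phi)$ only at $0$. Then $|A| \leq 2q^{n}e^{-m^2/(2nd^2)}$. *)

theory Defs
  imports Complex_Main "HOL-Library.Poly_Mapping" "HOL-Analysis.Finite_Cartesian_Product"
begin

text \<open>Polynomials over \<open>'a\<close> in variables indexed by \<open>'v\<close>: a monomial is a finitely supported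
  exponent function, a polynomial a finitely supported coefficient function on monomials.\<close>

type_synonym ('v, 'a) mv_poly = "('v \<Rightarrow>\<^sub>0 nat) \<Rightarrow>\<^sub>0 'a"

definition monom_degree :: "('v::finite \<Rightarrow>\<^sub>0 nat) \<Rightarrow> nat" where
  "monom_degree \<mu> = (\<Sum>j\<in>UNIV. Poly_Mapping.lookup \<mu> j)"

text \<open>The zero polynomial has total degree \<open>0\<close>.\<close>

definition total_degree :: "('v::finite, 'a::zero) mv_poly \<Rightarrow> nat" where
  "total_degree p = Max (insert 0 (monom_degree ` Poly_Mapping.keys p))"

definition mv_eval :: "('v::finite, 'a::comm_semiring_1) mv_poly \<Rightarrow> 'a ^ 'v \<Rightarrow> 'a" where
  "mv_eval p x =
     (\<Sum>\<mu>\<in>Poly_Mapping.keys p.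
        Poly_Mapping.lookup p \<mu> * (\<Prod>j\<in>UNIV. (x $ j) ^ Poly_Mapping.lookup \<mu> j))"

definition poly_map :: "('v::finite, 'a::comm_semiring_1) mv_poly ^ 'w \<Rightarrow> 'a ^ 'v \<Rightarrow> 'a ^ 'w" where
  "poly_map \<phi> x = (\<chi> i. mv_eval (\<phi> $ i) x)"

end

theory Submission
  imports Defs "HOL-Analysis.Cartesian_Space" "HOL-Computational_Algebra.Polynomial"
begin

text \<open>With \<open>g x y z = (\<Prod>i. 1 - (y\<^sub>i - z\<^sub>i - \<phi>\<^sub>i x) ^ (q - 1))\<close>, the function \<open>\<Sum>x. g x y z\<close> counts
  \<open>|\<Phi>\<^sup>-\<^sup>1(y - z)|\<close> in the field, so on \<open>A \<times> A\<close> it is a nonzero multiple of the identity matrix.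
  Give \<open>x\<close>-variables weight \<open>1\<close> and \<open>y\<close>-, \<open>z\<close>-variables weight \<open>d\<close>: then \<open>g\<close> has weight at most
  \<open>n d (q - 1)\<close>, and summation over \<open>x\<close> kills all monomials of \<open>x\<close>-degree below \<open>m (q - 1)\<close>. What
  is left has degree at most \<open>(n - m/d) (q - 1)\<close> in \<open>(y, z)\<close>, and by the argument of Croot, Lev and
  Pach its rank on \<open>A \<times> A\<close> is at most twice the number of reduced monomials in \<open>n\<close> variables of half
  that degree. A Chernoff bound for the uniform distribution on \<open>{0..q-1}\<close> estimates this number.\<close>

section \<open>Power sums over a finite field\<close>

text \<open>Translation by 1 permutes the ring, so the sum of all elements equals itself plus
  \<open>CARD('a)\<close> ones.\<close>

lemma of_nat_card_eq_0: "of_nat (CARD('a::{ring_1,finite})) = (0 :: 'a)"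
proof -
  have "(\<Sum>x\<in>(UNIV::'a set). x) = (\<Sum>x\<in>UNIV. x + 1)"
    by (rule sum.reindex_bij_witness[of _ "\<lambda>x. x + 1" "\<lambda>x. x - 1"]) auto
  also have "\<dots> = (\<Sum>x\<in>UNIV. x) + of_nat (CARD('a))"
    by (simp add: sum.distrib)
  finally show ?thesis by simp
qed

text \<open>The characteristic divides \<open>CARD('a)\<close>; if it divided \<open>k\<close> too,
  it would be 1. This later makes the diagonal entry of the matrix nonzero.\<close>

lemma of_nat_neq_0_if_coprime_card:
  assumes "coprime k (CARD('a::{field,finite}))"
  shows "of_nat k \<noteq> (0 :: 'a)"
proof
  assume "of_nat k = (0 :: 'a)"
  then have "CHAR('a) dvd k" by (simp add: of_nat_eq_0_iff_char_dvd)
  moreover have "CHAR('a) dvd CARD('a)"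
    using of_nat_card_eq_0[where 'a='a] by (simp add: of_nat_eq_0_iff_char_dvd)
  ultimately have "CHAR('a) = 1"
    using assms by (metis coprime_common_divisor_nat)
  then show False by simp
qed

lemma card_field_ge_2: "CARD('a::{field,finite}) \<ge> 2"
proof -
  have "card {0::'a, 1} \<le> CARD('a)" by (rule card_mono) auto
  then show ?thesis by simp
qed

text \<open>Multiplication by \<open>x\<close> permutes the nonzero elements; comparing their
  products gives the claim.\<close>

lemma nonzero_power_card_minus_1:
  fixes x :: "'a::{field,finite}"
  assumes "x \<noteq> 0"
  shows "x ^ (CARD('a) - 1) = 1"
proof -
  have "(\<Prod>y\<in>UNIV - {0}. y) = (\<Prod>y\<in>UNIV - {0}. x * y)"
    by (rule prod.reindex_bij_witness[of _ "\<lambda>y. x * y" "\<lambda>y. y / x"]) (use assms in auto)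
  also have "\<dots> = x ^ (CARD('a) - 1) * (\<Prod>y\<in>UNIV - {0}. y)"
    by (simp add: prod.distrib card_Diff_singleton)
  finally show ?thesis by simp
qed

lemma indicator_zero_power:
  fixes x :: "'a::{field,finite}"
  shows "1 - x ^ (CARD('a) - 1) = (if x = 0 then 1 else 0)"
  using nonzero_power_card_minus_1[of x] card_field_ge_2[where 'a='a] by simp

text \<open>For \<open>a > 0\<close>, the substitution of \<open>c * x\<close> for \<open>x\<close>
  multiplies the sum by \<open>c ^ a\<close>. Some nonzero \<open>c\<close> has
  \<open>c ^ a \<noteq> 1\<close>, as \<open>x ^ a - 1\<close> has at most \<open>a\<close> roots,
  fewer than there are nonzero elements.\<close>

lemma sum_power_eq_0:
  assumes "a < CARD('a) - 1"
  shows "(\<Sum>x\<in>UNIV. x ^ a) = (0 :: 'a::{field,finite})"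
proof (cases "a = 0")
  case True
  then show ?thesis using of_nat_card_eq_0[where 'a='a] by simp
next
  case False
  define p :: "'a poly" where "p = monom 1 a - 1"
  have "coeff p a = 1" using False by (simp add: p_def)
  then have "p \<noteq> 0" by auto
  have "degree p \<le> a"
    unfolding p_def by (intro degree_diff_le) (simp_all add: degree_monom_le)
  then have "card {x. poly p x = 0} \<le> a"
    using card_poly_roots_bound[OF \<open>p \<noteq> 0\<close>] by linarith
  then have "card {x. poly p x = 0} < card (UNIV - {0::'a})"
    using assms by (simp add: card_Diff_singleton)
  then obtain c :: 'a where c: "c \<noteq> 0" "poly p c \<noteq> 0"
    by (metis (mono_tags, lifting) DiffD2 card_mono finite insertCI linorder_not_less mem_Collect_eq subsetI)
  have "(\<Sum>x\<in>(UNIV::'a set). x ^ a) = (\<Sum>x\<in>UNIV. (c * x) ^ a)"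
    by (rule sum.reindex_bij_witness[of _ "\<lambda>y. c * y" "\<lambda>y. y / c"]) (use c in auto)
  also have "\<dots> = c ^ a * (\<Sum>x\<in>UNIV. x ^ a)"
    by (simp add: power_mult_distrib sum_distrib_left)
  finally have "(c ^ a - 1) * (\<Sum>x\<in>(UNIV::'a set). x ^ a) = 0"
    by (simp add: algebra_simps)
  with c show ?thesis by (simp add: p_def poly_monom)
qed

lemma reduce_exponent:
  "\<exists>b. b \<le> a \<and> b < CARD('a) \<and> (\<forall>x::'a::{field,finite}. x ^ b = x ^ a)"
proof (induction a rule: less_induct)
  case (less a)
  show ?case
  proof (cases "a < CARD('a)")
    case False
    \<comment> \<open>Lowering the exponent by \<open>q - 1\<close> preserves the power at nonzero
      \<open>x\<close>. Since \<open>a \<ge> q\<close>, the new exponent stays positive, so the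
      value at 0 is preserved as well.\<close>
    define a' where "a' = a - (CARD('a) - 1)"
    have a: "a = a' + (CARD('a) - 1)" and "a' > 0" "a' < a"
      using False card_field_ge_2[where 'a='a] by (auto simp: a'_def)
    have "x ^ a' = x ^ a" for x :: 'a
    proof (cases "x = 0")
      case True
      then show ?thesis using \<open>a' > 0\<close> \<open>a' < a\<close> by (simp add: zero_power)
    next
      case False
      then have "x ^ (CARD('a) - 1) = 1" by (rule nonzero_power_card_minus_1)
      then show ?thesis by (simp only: a power_add mult_1_right)
    qed
    moreover obtain b where "b \<le> a'" "b < CARD('a)" "\<And>x::'a. x ^ b = x ^ a'"
      using less.IH[OF \<open>a' < a\<close>] by blast
    ultimately show ?thesis using \<open>a' < a\<close> by (intro exI[of _ b]) simp
  qed auto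
qed

section \<open>Polynomial functions in three groups of variables\<close>

definition monomial :: "('v::finite \<Rightarrow> nat) \<Rightarrow> 'a::comm_semiring_1 ^ 'v \<Rightarrow> 'a" where
  "monomial e x = (\<Prod>i\<in>UNIV. (x $ i) ^ e i)"

lemma monomial_0 [simp]: "monomial (\<lambda>_. 0) x = 1"
  by (simp add: monomial_def)

lemma monomial_add: "monomial (\<lambda>i. e i + f i) x = monomial e x * monomial f x"
  by (simp add: monomial_def power_add prod.distrib)

lemma monomial_unit: "monomial (\<lambda>j. if j = i then 1 else 0) x = x $ i"
proof -
  have "monomial (\<lambda>j. if j = i then 1 else 0) x = (\<Prod>j\<in>UNIV. if j = i then x $ j else 1)"
    unfolding monomial_def by (rule prod.cong) auto
  then show ?thesis by simp
qed

lemma reduce_monomial: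
  fixes e :: "'v::finite \<Rightarrow> nat"
  shows "\<exists>f. (\<forall>i. f i < CARD('a)) \<and> sum f UNIV \<le> sum e UNIV \<and>
    (\<forall>x::'a::{field,finite}^'v. monomial f x = monomial e x)"
proof -
  have "\<exists>f. \<forall>i. f i \<le> e i \<and> f i < CARD('a) \<and> (\<forall>x::'a. x ^ f i = x ^ e i)"
    using reduce_exponent[where 'a='a] by (intro choice) auto
  then obtain f where "\<And>i. f i \<le> e i" "\<And>i. f i < CARD('a)" "\<And>i (x::'a). x ^ f i = x ^ e i"
    by blast
  then show ?thesis
    by (intro exI[of _ f]) (auto simp: monomial_def intro: sum_mono)
qed

text \<open>Distributivity, with vectors identified with functions on the index type.\<close>

lemma sum_UNIV_vec_prod:
  fixes g :: "'v::finite \<Rightarrow> 'a::finite \<Rightarrow> 'b::comm_semiring_1"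
  shows "(\<Sum>x\<in>UNIV. \<Prod>i\<in>UNIV. g i (x $ i)) = (\<Prod>i\<in>UNIV. \<Sum>t\<in>UNIV. g i t)"
proof -
  have "(\<Prod>i\<in>UNIV. \<Sum>t\<in>UNIV. g i t) = (\<Sum>h\<in>PiE UNIV (\<lambda>_. UNIV). \<Prod>i\<in>UNIV. g i (h i))"
    by (rule prod_sum_PiE) auto
  also have "\<dots> = (\<Sum>x\<in>UNIV. \<Prod>i\<in>UNIV. g i (x $ i))"
    by (rule sum.reindex_bij_witness[of _ vec_nth "\<lambda>h. \<chi> i. h i"]) (auto simp: PiE_UNIV_domain)
  finally show ?thesis ..
qed

text \<open>By pigeonhole some exponent is below \<open>q - 1\<close>; the sum factors over the
  coordinates, and the factor of that coordinate vanishes.\<close>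

lemma sum_monomial_eq_0:
  fixes e :: "'v::finite \<Rightarrow> nat"
  assumes "sum e UNIV < CARD('v) * (CARD('a) - 1)"
  shows "(\<Sum>x\<in>UNIV. monomial e x) = (0 :: 'a::{field,finite})"
proof -
  have "\<exists>i. e i < CARD('a) - 1"
  proof (rule ccontr)
    assume "\<not> ?thesis"
    then have "(\<Sum>i\<in>(UNIV::'v set). CARD('a) - 1) \<le> sum e UNIV"
      by (intro sum_mono) (auto simp: not_less)
    with assms show False by simp
  qed
  then obtain i where "e i < CARD('a) - 1" ..
  then have "(\<Sum>t\<in>(UNIV::'a set). t ^ e i) = 0" by (rule sum_power_eq_0)
  then show ?thesis
    unfolding monomial_def sum_UNIV_vec_prod[of "\<lambda>i t. t ^ e i"] by (intro prod_zero) auto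
qed

section \<open>Functions represented by polynomials of bounded weight\<close>

text \<open>A predicate on functions instead of formal polynomials: it only asserts that some
  representation has weight at most \<open>k\<close>, so linear claims follow by induction on
  monomials and sums. The weight \<open>d\<close> of \<open>y\<close> and \<open>z\<close> makes
  each \<open>y $ i - z $ i - \<phi>_i(x)\<close> have weight at most \<open>d\<close>.\<close>

inductive weighted_poly ::
  "nat \<Rightarrow> nat \<Rightarrow> ('a::field ^ 'm::finite \<Rightarrow> 'a ^ 'n::finite \<Rightarrow> 'a ^ 'n \<Rightarrow> 'a) \<Rightarrow> bool"
  for d k where
  monomial: "sum a UNIV + d * (sum e UNIV + sum f UNIV) \<le> k \<Longrightarrow>
    weighted_poly d k (\<lambda>x y z. c * monomial a x * monomial e y * monomial f z)"
| add: "weighted_poly d k g \<Longrightarrow> weighted_poly d k h \<Longrightarrow> weighted_poly d k (\<lambda>x y z. g x y z + h x y z)"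

lemma weighted_poly_const: "weighted_poly d k (\<lambda>x y z. c)"
  using weighted_poly.monomial[of "\<lambda>_. 0" d "\<lambda>_. 0" "\<lambda>_. 0" k c] by simp

lemma weighted_poly_mult:
  assumes "weighted_poly d k g" "weighted_poly d l h"
  shows "weighted_poly d (k + l) (\<lambda>x y z. g x y z * h x y z)"
  using assms(1)
proof induction
  case (monomial a e f c)
  show ?case using assms(2)
  proof induction
    case (monomial a' e' f' c')
    have "weighted_poly d (k + l) (\<lambda>x y z. (c * c') * monomial (\<lambda>i. a i + a' i) x *
        monomial (\<lambda>i. e i + e' i) y * monomial (\<lambda>i. f i + f' i) z)"
      using monomial \<open>sum a UNIV + _ \<le> k\<close>
      by (intro weighted_poly.monomial) (simp add: sum.distrib algebra_simps)
    then show ?case by (simp add: monomial_add mult_ac)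
  qed (simp add: distrib_left weighted_poly.add)
qed (simp add: distrib_right weighted_poly.add)

lemma weighted_poly_uminus:
  assumes "weighted_poly d k g"
  shows "weighted_poly d k (\<lambda>x y z. - g x y z)"
  using weighted_poly_mult[OF weighted_poly_const[of d 0 "- 1"] assms] by simp

lemma weighted_poly_diff:
  assumes "weighted_poly d k g" "weighted_poly d k h"
  shows "weighted_poly d k (\<lambda>x y z. g x y z - h x y z)"
  using weighted_poly.add[OF assms(1) weighted_poly_uminus[OF assms(2)]] by simp

lemma weighted_poly_sum:
  assumes "finite I" "\<And>i. i \<in> I \<Longrightarrow> weighted_poly d k (g i)"
  shows "weighted_poly d k (\<lambda>x y z. \<Sum>i\<in>I. g i x y z)"
  using assms by induction (auto intro: weighted_poly_const weighted_poly.add)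

lemma weighted_poly_prod:
  assumes "finite I" "\<And>i. i \<in> I \<Longrightarrow> weighted_poly d k (g i)"
  shows "weighted_poly d (card I * k) (\<lambda>x y z. \<Prod>i\<in>I. g i x y z)"
  using assms by induction (auto intro: weighted_poly_const weighted_poly_mult)

lemma weighted_poly_power:
  assumes "weighted_poly d k g"
  shows "weighted_poly d (r * k) (\<lambda>x y z. g x y z ^ r)"
  using weighted_poly_prod[of "{..<r}" d k "\<lambda>_. g"] assms by simp

lemma weighted_poly_snd: "weighted_poly d d (\<lambda>x y z. y $ i)"
  using weighted_poly.monomial[of "\<lambda>_. 0" d "\<lambda>j. if j = i then 1 else 0" "\<lambda>_. 0" d 1]
  by (simp add: monomial_unit)

lemma weighted_poly_trd: "weighted_poly d d (\<lambda>x y z. z $ i)"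
  using weighted_poly.monomial[of "\<lambda>_. 0" d "\<lambda>_. 0" "\<lambda>j. if j = i then 1 else 0" d 1]
  by (simp add: monomial_unit)

lemma weighted_poly_mv_eval:
  assumes "total_degree p \<le> d"
  shows "weighted_poly d d (\<lambda>x y z. mv_eval p x)"
  unfolding mv_eval_def
proof (rule weighted_poly_sum)
  fix \<mu> assume "\<mu> \<in> Poly_Mapping.keys p"
  then have "monom_degree \<mu> \<le> total_degree p"
    unfolding total_degree_def by (intro Max_ge) auto
  then have "sum (Poly_Mapping.lookup \<mu>) UNIV \<le> d"
    using assms by (simp add: monom_degree_def)
  then show "weighted_poly d d (\<lambda>x y z. Poly_Mapping.lookup p \<mu> *
      (\<Prod>j\<in>UNIV. (x $ j) ^ Poly_Mapping.lookup \<mu> j))"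
    using weighted_poly.monomial[of "Poly_Mapping.lookup \<mu>" d "\<lambda>_. 0" "\<lambda>_. 0" d
        "Poly_Mapping.lookup p \<mu>"]
    by (simp add: monomial_def)
qed simp

section \<open>The slice decomposition and the rank bound\<close>

text \<open>Summation over \<open>x\<close> only keeps monomials of \<open>x\<close>-degree at least \<open>m (q - 1)\<close>; in each of these
  the \<open>y\<close>-part or the \<open>z\<close>-part uses up at most half of the remaining weight.\<close>

lemma sum_weighted_poly_decomposition:
  fixes g :: "'a::{field,finite} ^ 'm::finite \<Rightarrow> 'a ^ 'n::finite \<Rightarrow> 'a ^ 'n \<Rightarrow> 'a"
  assumes "weighted_poly d k g"
  defines "S \<equiv> {e :: 'n \<Rightarrow> nat. (\<forall>i. e i < CARD('a)) \<and>
      2 * d * sum e UNIV + CARD('m) * (CARD('a) - 1) \<le> k}"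
  assumes "finite S"
  shows "\<exists>G H. \<forall>y z. (\<Sum>x\<in>UNIV. g x y z) =
    (\<Sum>e\<in>S. monomial e y * G e z) + (\<Sum>e\<in>S. H e y * monomial e z)"
  using assms(1)
proof induction
  case (monomial a e f c)
  define s where "s = c * (\<Sum>x\<in>UNIV. monomial a (x :: 'a ^ 'm))"
  have eq: "(\<Sum>x\<in>UNIV. c * monomial a (x :: 'a ^ 'm) * monomial e y * monomial f z) =
      s * monomial e y * monomial f z" for y z :: "'a ^ 'n"
    by (simp add: s_def sum_distrib_left sum_distrib_right)
  have single: "(\<Sum>e'\<in>S. if e' = e0 then u e' else 0) = u e0" if "e0 \<in> S" for e0 and u :: "_ \<Rightarrow> 'a"
    using that \<open>finite S\<close> by simp
  show ?case
  proof (cases "sum a UNIV < CARD('m) * (CARD('a) - 1)")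
    case True
    then have "s = 0" by (simp add: s_def sum_monomial_eq_0)
    then show ?thesis unfolding eq by (intro exI[of _ "\<lambda>_ _. 0"]) simp
  next
    case False
    \<comment> \<open>Exponents are reduced below \<open>q\<close> because \<open>S\<close> contains
      only such exponents; the degree does not grow, so the weight bound survives.\<close>
    obtain e' where e': "\<And>i. e' i < CARD('a)" "sum e' UNIV \<le> sum e UNIV"
      "\<And>y :: 'a ^ 'n. monomial e' y = monomial e y"
      using reduce_monomial[where 'a='a, of e] by blast
    obtain f' where f': "\<And>i. f' i < CARD('a)" "sum f' UNIV \<le> sum f UNIV"
      "\<And>y :: 'a ^ 'n. monomial f' y = monomial f y"
      using reduce_monomial[where 'a='a, of f] by blast
    have k: "CARD('m) * (CARD('a) - 1) + d * (sum e' UNIV + sum f' UNIV) \<le> k"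
    proof -
      have "d * (sum e' UNIV + sum f' UNIV) \<le> d * (sum e UNIV + sum f UNIV)"
        using e'(2) f'(2) by (intro mult_left_mono) auto
      then show ?thesis using monomial False by linarith
    qed
    show ?thesis
    proof (cases "sum e' UNIV \<le> sum f' UNIV")
      case True
      then have "d * sum e' UNIV \<le> d * sum f' UNIV" by simp
      then have "2 * d * sum e' UNIV \<le> d * (sum e' UNIV + sum f' UNIV)" by (simp add: distrib_left)
      with k have "2 * d * sum e' UNIV + CARD('m) * (CARD('a) - 1) \<le> k" by linarith
      then have "e' \<in> S" using e'(1) by (simp add: S_def)
      \<comment> \<open>The whole term is charged to the single index \<open>e'\<close>; the
        cofactor in \<open>z\<close> is arbitrary, so \<open>f\<close> may stay unreduced.\<close>
      let ?G = "\<lambda>e0 z. if e0 = e' then s * monomial f z else 0"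
      have "(\<Sum>e0\<in>S. monomial e0 y * ?G e0 z) = s * monomial e y * monomial f z" for y z :: "'a ^ 'n"
        using single[OF \<open>e' \<in> S\<close>, of "\<lambda>e0. monomial e0 y * (s * monomial f z)"]
        by (simp add: e'(3) if_distrib cong: if_cong)
      then show ?thesis
        unfolding eq by (intro exI[of _ ?G] exI[of _ "\<lambda>_ _. 0"]) simp
    next
      case False
      then have "d * sum f' UNIV \<le> d * sum e' UNIV" by simp
      then have "2 * d * sum f' UNIV \<le> d * (sum e' UNIV + sum f' UNIV)" by (simp add: distrib_left)
      with k have "2 * d * sum f' UNIV + CARD('m) * (CARD('a) - 1) \<le> k" by linarith
      then have "f' \<in> S" using f'(1) by (simp add: S_def)
      let ?H = "\<lambda>f0 y. if f0 = f' then s * monomial e y else 0"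
      have "(\<Sum>f0\<in>S. ?H f0 y * monomial f0 z) = s * monomial e y * monomial f z" for y z :: "'a ^ 'n"
        using single[OF \<open>f' \<in> S\<close>, of "\<lambda>f0. s * monomial e y * monomial f0 z"]
        by (simp add: f'(3) if_distrib if_distribR cong: if_cong)
      then show ?thesis
        unfolding eq by (intro exI[of _ "\<lambda>_ _. 0"] exI[of _ ?H]) simp
    qed
  qed
next
  case (add g h)
  then obtain G1 H1 G2 H2 where
    "\<And>y z. (\<Sum>x\<in>UNIV. g x y z) = (\<Sum>e\<in>S. monomial e y * G1 e z) + (\<Sum>e\<in>S. H1 e y * monomial e z)"
    "\<And>y z. (\<Sum>x\<in>UNIV. h x y z) = (\<Sum>e\<in>S. monomial e y * G2 e z) + (\<Sum>e\<in>S. H2 e y * monomial e z)"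
    by blast
  then show ?case
    by (intro exI[of _ "\<lambda>e z. G1 e z + G2 e z"] exI[of _ "\<lambda>e z. H1 e z + H2 e z"])
      (simp add: sum.distrib distrib_left distrib_right)
qed

text \<open>The matrix on \<open>A\<close> is \<open>c\<close> times the identity, while its columns
  lie in the span of at most \<open>2 * card S\<close> vectors. Hence that span contains
  \<open>card A\<close> independent unit vectors.\<close>

lemma card_le_slice_rank:
  fixes A :: "'b::finite set" and u v G H :: "'e \<Rightarrow> 'b \<Rightarrow> 'a::field"
  assumes "finite S" "c \<noteq> 0"
    and "\<And>y z. y \<in> A \<Longrightarrow> z \<in> A \<Longrightarrow>
      (\<Sum>e\<in>S. u e y * G e z) + (\<Sum>e\<in>S. H e y * v e z) = (if y = z then c else 0)"
  shows "card A \<le> 2 * card S"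
proof -
  define U :: "'e \<Rightarrow> 'a ^ 'b" where "U e = (\<chi> y. if y \<in> A then u e y else 0)" for e
  define V :: "'e \<Rightarrow> 'a ^ 'b" where "V e = (\<chi> y. if y \<in> A then H e y else 0)" for e
  let ?T = "U ` S \<union> V ` S"
  let ?B = "(\<lambda>z. axis z 1 :: 'a ^ 'b) ` A"
  have "axis z 1 \<in> vec.span ?T" if "z \<in> A" for z
  proof -
    \<comment> \<open>Column \<open>z\<close> of the matrix divided by \<open>c\<close>; extension
      by zero outside \<open>A\<close> makes the identity hold in every coordinate.\<close>
    have "axis z 1 = inverse c *s ((\<Sum>e\<in>S. G e z *s U e) + (\<Sum>e\<in>S. v e z *s V e))"
    proof (rule vec_eq_iff[THEN iffD2], rule allI)
      fix y
      show "axis z 1 $ y = (inverse c *s ((\<Sum>e\<in>S. G e z *s U e) + (\<Sum>e\<in>S. v e z *s V e))) $ y"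
      proof (cases "y \<in> A")
        case True
        then show ?thesis using assms(3)[OF True that] \<open>c \<noteq> 0\<close>
          by (simp add: U_def V_def axis_def mult.commute)
      next
        case False
        then show ?thesis using that by (auto simp: U_def V_def axis_def)
      qed
    qed
    also have "\<dots> \<in> vec.span ?T"
      by (intro vec.span_scale vec.span_add vec.span_sum) (auto intro: vec.span_base)
    finally show ?thesis .
  qed
  then have "?B \<subseteq> vec.span ?T" by auto
  moreover have "vec.independent ?B"
    by (rule vec.independent_mono[OF independent_cart_basis]) (auto simp: cart_basis_def)
  ultimately have "card ?B \<le> card ?T"
    using vec.independent_span_bound[of ?T ?B] \<open>finite S\<close> by auto
  also have "\<dots> \<le> card S + card S"
    using card_Un_le[of "U ` S" "V ` S"] card_image_le[OF \<open>finite S\<close>, of U]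
      card_image_le[OF \<open>finite S\<close>, of V] by linarith
  finally show ?thesis
    by (simp add: card_image inj_on_def axis_eq_axis)
qed

section \<open>Counting exponents of small degree\<close>

text \<open>Termwise comparison of the power series, using
  \<open>2 ^ k * fact k \<le> fact (2 * k)\<close>.\<close>

lemma cosh_le_exp_square_half: "cosh t \<le> exp (t\<^sup>2 / 2)" for t :: real
proof (rule sums_le)
  let ?c = "\<lambda>k. if even k then t ^ k /\<^sub>R fact k else 0"
  \<comment> \<open>The odd terms vanish, so the series may be indexed by half the exponent.\<close>
  have "(\<lambda>k. ?c (2 * k)) sums cosh t \<longleftrightarrow> ?c sums cosh t"
    by (rule sums_mono_reindex) (auto simp: strict_mono_def elim!: evenE)
  then show "(\<lambda>k. t ^ (2 * k) /\<^sub>R fact (2 * k)) sums cosh t"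
    using cosh_converges[of t] by simp
  show "(\<lambda>k. (t\<^sup>2 / 2) ^ k /\<^sub>R fact k) sums exp (t\<^sup>2 / 2)"
    by (rule exp_converges)
  fix k :: nat
  have "2 ^ k * fact k \<le> (fact (2 * k) :: real)"
  proof (induction k)
    case (Suc k)
    have "2 ^ Suc k * fact (Suc k) = (2 * real k + 2) * (2 ^ k * fact k :: real)"
      by (simp add: algebra_simps)
    also have "\<dots> \<le> (2 * real k + 2) * ((2 * real k + 1) * fact (2 * k))"
    proof (intro mult_left_mono)
      have "fact (2 * k) \<le> (2 * real k + 1) * fact (2 * k)" by (simp add: distrib_right)
      with Suc show "2 ^ k * fact k \<le> (2 * real k + 1) * fact (2 * k)" by linarith
    qed simp
    also have "\<dots> = fact (2 * Suc k)" by (simp add: algebra_simps)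
    finally show ?case .
  qed simp
  then have le: "t ^ (2 * k) / fact (2 * k) \<le> t ^ (2 * k) / (2 ^ k * fact k)"
    by (intro divide_left_mono) auto
  have *: "(t\<^sup>2 / 2) ^ k /\<^sub>R fact k = t ^ (2 * k) / (2 ^ k * fact k)"
    unfolding power_divide power_mult[symmetric] real_scaleR_def by (simp add: divide_inverse)
  from le show "t ^ (2 * k) /\<^sub>R fact (2 * k) \<le> (t\<^sup>2 / 2) ^ k /\<^sub>R fact k"
    unfolding * by (simp add: divide_inverse mult.commute)
qed

text \<open>Hoeffding's bound on the moment generating function of the uniform distribution on
  \<open>{0..q-1}\<close>. The reflection of \<open>j\<close> to \<open>q - 1 - j\<close> turns
  \<open>exp\<close> into \<open>cosh\<close>, and deviations from the mean are at most
  \<open>(q - 1) / 2\<close>.\<close>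

lemma sum_exp_centred_le:
  fixes l :: real
  shows "(\<Sum>j<q. exp (l * ((real q - 1) / 2 - real j))) \<le> real q * exp (l\<^sup>2 * (real q - 1)\<^sup>2 / 8)"
proof -
  let ?t = "\<lambda>j. l * ((real q - 1) / 2 - real j)"
  have "(\<Sum>j<q. exp (?t j)) = (\<Sum>j<q. exp (- ?t j))"
  proof (rule sum.reindex_bij_witness[of _ "\<lambda>j. q - 1 - j" "\<lambda>j. q - 1 - j"])
    fix j assume "j \<in> {..<q}"
    then have "real (q - 1 - j) = real q - 1 - real j" by auto
    then have "- ?t (q - 1 - j) = ?t j" by (simp add: field_simps)
    then show "exp (- ?t (q - 1 - j)) = exp (?t j)" by simp
  qed auto
  then have "(\<Sum>j<q. exp (?t j)) = (\<Sum>j<q. cosh (?t j))"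
    by (simp add: cosh_field_def sum_divide_distrib[symmetric] sum.distrib)
  also have "\<dots> \<le> (\<Sum>j<q. exp (l\<^sup>2 * (real q - 1)\<^sup>2 / 8))"
  proof (rule sum_mono)
    fix j assume "j \<in> {..<q}"
    then have "real j \<le> real q - 1" by simp
    moreover have "\<bar>h - x\<bar> \<le> h" if "0 \<le> x" "x \<le> h + h" for h x :: real
      using that by linarith
    ultimately have "\<bar>(real q - 1) / 2 - real j\<bar> \<le> (real q - 1) / 2"
      by (metis field_sum_of_halves of_nat_0_le_iff)
    then have "((real q - 1) / 2 - real j)\<^sup>2 \<le> ((real q - 1) / 2)\<^sup>2"
      by (rule abs_le_square_iff[THEN iffD1, OF order_trans[OF _ abs_ge_self]])
    then have "l\<^sup>2 * ((real q - 1) / 2 - real j)\<^sup>2 \<le> l\<^sup>2 * ((real q - 1) / 2)\<^sup>2"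
      by (rule mult_left_mono) simp
    then have le: "(?t j)\<^sup>2 / 2 \<le> l\<^sup>2 * (real q - 1)\<^sup>2 / 8"
      by (simp add: power_mult_distrib power_divide)
    have "cosh (?t j) \<le> exp ((?t j)\<^sup>2 / 2)" by (rule cosh_le_exp_square_half)
    also have "\<dots> \<le> exp (l\<^sup>2 * (real q - 1)\<^sup>2 / 8)" using le by (simp only: exp_le_cancel_iff)
    finally show "cosh (?t j) \<le> exp (l\<^sup>2 * (real q - 1)\<^sup>2 / 8)" .
  qed
  finally show ?thesis by simp
qed

text \<open>Chernoff's method: every \<open>e\<close> in \<open>S\<close> has exponential weight at
  least \<open>exp (m^2 / (n d^2))\<close>, while the total weight of the box is a product over
  coordinates, at most \<open>q^n exp (m^2 / (2 n d^2))\<close>.\<close>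

lemma card_small_degree_le:
  fixes q d m :: nat
  defines "S \<equiv> {e :: 'n::finite \<Rightarrow> nat. (\<forall>i. e i < q) \<and>
      2 * d * sum e UNIV + m * (q - 1) \<le> CARD('n) * (d * (q - 1))}"
  assumes "2 \<le> q" "0 < d"
  shows "finite S"
    and "real (card S) \<le> real q ^ CARD('n) * exp (- ((real m)\<^sup>2 / (2 * real (CARD('n)) * (real d)\<^sup>2)))"
proof -
  define n where "n = real (CARD('n))"
  define r where "r = real q - 1"
  \<comment> \<open>This value minimises \<open>n l^2 r^2 / 8 - l m r / (2 d)\<close>, the exponent
    in the resulting bound.\<close>
  define l where "l = 2 * real m / (n * real d * r)"
  have pos: "n > 0" "r > 0" using assms by (auto simp: n_def r_def)
  let ?P = "PiE UNIV (\<lambda>_. {..<q}) :: ('n \<Rightarrow> nat) set"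
  have "finite ?P" by (intro finite_PiE) auto
  have "S \<subseteq> ?P" by (auto simp: S_def PiE_UNIV_domain)
  then show "finite S" using \<open>finite ?P\<close> finite_subset by blast
  have weight: "(\<Prod>i\<in>UNIV. exp (l * (r / 2 - real (e i)))) = exp (l * (n * r / 2 - real (sum e UNIV)))"
    for e :: "'n \<Rightarrow> nat"
    by (simp add: exp_sum[symmetric] sum_distrib_left[symmetric] sum_subtractf n_def)
  have "exp (real m ^ 2 / (n * real d ^ 2)) \<le> (\<Prod>i\<in>UNIV. exp (l * (r / 2 - real (e i))))"
    if "e \<in> S" for e
  proof -
    have "real (2 * d * sum e UNIV + m * (q - 1)) \<le> real (CARD('n) * (d * (q - 1)))"
      using that unfolding S_def of_nat_le_iff by blast
    then have "2 * real d * real (sum e UNIV) + real m * r \<le> n * (real d * r)"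
      using assms by (simp add: n_def r_def of_nat_diff)
    \<comment> \<open>The degree of \<open>e\<close> lies at least \<open>m r / (2 d)\<close> below
      its mean \<open>n r / 2\<close>.\<close>
    then have "real m * r / (2 * real d) \<le> n * r / 2 - real (sum e UNIV)"
      using assms by (simp add: field_simps)
    then have "l * (real m * r / (2 * real d)) \<le> l * (n * r / 2 - real (sum e UNIV))"
      using pos by (intro mult_left_mono) (auto simp: l_def)
    moreover have "l * (real m * r / (2 * real d)) = real m ^ 2 / (n * real d ^ 2)"
      using pos assms by (simp add: l_def field_simps power2_eq_square)
    ultimately show ?thesis unfolding weight by simp
  qed
  then have "(\<Sum>e\<in>S. exp (real m ^ 2 / (n * real d ^ 2))) \<le>
      (\<Sum>e\<in>S. \<Prod>i\<in>UNIV. exp (l * (r / 2 - real (e i))))"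
    by (rule sum_mono)
  also have "\<dots> \<le> (\<Sum>e\<in>?P. \<Prod>i\<in>UNIV. exp (l * (r / 2 - real (e i))))"
    using \<open>S \<subseteq> ?P\<close> \<open>finite ?P\<close> by (intro sum_mono2) (auto intro: prod_nonneg)
  also have "\<dots> = (\<Prod>i\<in>(UNIV::'n set). \<Sum>j<q. exp (l * (r / 2 - real j)))"
    by (rule prod_sum_PiE[symmetric]) auto
  also have "\<dots> \<le> (\<Prod>i\<in>(UNIV::'n set). real q * exp (l\<^sup>2 * r\<^sup>2 / 8))"
    using sum_exp_centred_le[of l q] by (intro prod_mono) (auto simp: r_def intro: sum_nonneg)
  also have "\<dots> = real q ^ CARD('n) * exp (n * (l\<^sup>2 * r\<^sup>2 / 8))"
    unfolding n_def exp_of_nat_mult by (simp add: power_mult_distrib)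
  also have "n * (l\<^sup>2 * r\<^sup>2 / 8) = real m ^ 2 / (2 * n * real d ^ 2)"
    using pos assms by (simp add: l_def field_simps power2_eq_square)
  finally have "real (card S) * exp (real m ^ 2 / (n * real d ^ 2)) \<le>
      real q ^ CARD('n) * exp (real m ^ 2 / (2 * n * real d ^ 2))"
    by simp
  then have "real (card S) \<le> real q ^ CARD('n) *
      (exp (real m ^ 2 / (2 * n * real d ^ 2)) / exp (real m ^ 2 / (n * real d ^ 2)))"
    by (simp add: field_simps)
  also have "exp (real m ^ 2 / (2 * n * real d ^ 2)) / exp (real m ^ 2 / (n * real d ^ 2)) =
      exp (- (real m ^ 2 / (2 * n * real d ^ 2)))"
    using pos assms by (simp add: exp_diff[symmetric] field_simps)
  finally show "real (card S) \<le> real q ^ CARD('n) *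
      exp (- ((real m)\<^sup>2 / (2 * real (CARD('n)) * (real d)\<^sup>2)))"
    by (simp add: n_def)
qed

section \<open>Differences avoiding the nonzero values of a polynomial map\<close>

theorem theorem1p3:
  fixes \<phi> :: "('m::finite, 'a::{field,finite}) mv_poly ^ 'n::finite"
    and \<Phi> :: "'a ^ 'm \<Rightarrow> 'a ^ 'n"
    and A :: "('a ^ 'n) set"
    and q m n d :: nat
  assumes "q = CARD('a)" and "m = CARD('m)" and "n = CARD('n)"
    and "0 < m" and "m \<le> n"
    and "\<Phi> = poly_map \<phi>"
    and "\<And>i. total_degree (\<phi> $ i) \<le> d"
    and "coprime (card (\<Phi> -` {0})) q"
    and "{a - a' | a a'. a \<in> A \<and> a' \<in> A} \<inter> range \<Phi> \<subseteq> {0}"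
  shows "real (card A) \<le>
    2 * real q ^ n * exp (- ((real m)\<^sup>2 / (2 * real n * (real d)\<^sup>2)))"
proof (cases "d = 0")
  case True
  \<comment> \<open>Division by zero gives \<open>0\<close>, so the bound reads \<open>2 * q ^ n\<close>.\<close>
  have "card A \<le> CARD('a ^ 'n)" by (rule card_mono) auto
  then have "card A \<le> q ^ n" using assms by simp
  then have "real (card A) \<le> real q ^ n" by (metis of_nat_le_iff of_nat_power)
  moreover have "real q ^ n \<ge> 0" by simp
  ultimately have "real (card A) \<le> 2 * real q ^ n" by linarith
  then show ?thesis using True by simp
next
  case False
  have "q \<ge> 2" using card_field_ge_2[where 'a='a] assms(1) by simp
  \<comment> \<open>The index set of the slice decomposition for total weight
    \<open>n d (q - 1)\<close>.\<close>
  define S where "S = {e :: 'n \<Rightarrow> nat. (\<forall>i. e i < q) \<and>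
      2 * d * sum e UNIV + m * (q - 1) \<le> CARD('n) * (d * (q - 1))}"
  note S = card_small_degree_le[where 'n='n, OF \<open>q \<ge> 2\<close>, of d m, folded S_def]
  define g :: "'a ^ 'm \<Rightarrow> 'a ^ 'n \<Rightarrow> 'a ^ 'n \<Rightarrow> 'a" where
    "g = (\<lambda>x y z. \<Prod>i\<in>UNIV. 1 - (y $ i - z $ i - mv_eval (\<phi> $ i) x) ^ (q - 1))"
  have "weighted_poly d (CARD('n) * ((q - 1) * d)) g"
    unfolding g_def
    by (intro weighted_poly_prod weighted_poly_diff weighted_poly_const weighted_poly_power
        weighted_poly_snd weighted_poly_trd weighted_poly_mv_eval assms(7)) simp
  then obtain G H where GH: "\<And>y z. (\<Sum>x\<in>UNIV. g x y z) =
      (\<Sum>e\<in>S. monomial e y * G e z) + (\<Sum>e\<in>S. H e y * monomial e z)"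
    using sum_weighted_poly_decomposition[of d "CARD('n) * (d * (q - 1))" g] S(1) False assms(1,2)
    unfolding S_def by (auto simp: mult.commute)
  have g: "g x y z = (if \<Phi> x = y - z then 1 else 0)" for x y z
  proof -
    have "g x y z = (\<Prod>i\<in>UNIV. if y $ i - z $ i - mv_eval (\<phi> $ i) x = 0 then 1 else 0)"
      unfolding g_def assms(1) indicator_zero_power ..
    also have "\<dots> = (if \<forall>i. y $ i - z $ i = mv_eval (\<phi> $ i) x then 1 else 0)"
      by (auto intro: prod_zero)
    finally show ?thesis
      unfolding assms(6) by (auto simp: vec_eq_iff poly_map_def)
  qed
  have "card A \<le> 2 * card S"
  proof (rule card_le_slice_rank)
    \<comment> \<open>Coprimality enters here: the diagonal entry is the size of the zero fibre,
      read in the field.\<close>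
    show "of_nat (card (\<Phi> -` {0})) \<noteq> (0 :: 'a)"
      using of_nat_neq_0_if_coprime_card assms(1,8) by blast
    fix y z assume "y \<in> A" "z \<in> A"
    have "(\<Sum>x\<in>UNIV. g x y z) = of_nat (card (\<Phi> -` {y - z}))"
      unfolding g by (simp add: sum.If_cases vimage_def)
    also have "\<dots> = (if y = z then of_nat (card (\<Phi> -` {0})) else 0)"
    proof (cases "y = z")
      case neq: False
      \<comment> \<open>A preimage would put the nonzero difference \<open>y - z\<close> into the
        range of \<open>\<Phi>\<close>.\<close>
      then have "\<Phi> -` {y - z} = {}" using assms(9) \<open>y \<in> A\<close> \<open>z \<in> A\<close> by fastforce
      then show ?thesis using neq by simp
    qed simp
    finally show "(\<Sum>e\<in>S. monomial e y * G e z) + (\<Sum>e\<in>S. H e y * monomial e z) =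
        (if y = z then of_nat (card (\<Phi> -` {0})) else 0)"
      unfolding GH .
  qed (use S(1) False in simp)
  then have "real (card A) \<le> 2 * real (card S)" by linarith
  with S(2) False show ?thesis by (simp add: assms(3))
qed

end
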